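(* Let $k$ be a field of characteristic zero and let $A$ be a (not necessarily associative) $k$-algebra that is left-commutative, i.e. $a(bx)=b(ax)$ for all $a,b,x\in A$, and conservative. Let $F: A\times A\to A$ be the multiplication of an algebra $A^*$ associated to $A$. Suppose the annihilator $\{z\in A : zy=0 \text{ for all } y\in A\}$ of $A$ is zero. Then $A$ is a generalized associative algebra, i.e. $F(a,b)x=a(bx)$ for all $a,b,x\in A$, and the algebra $A^*$ is commutative, i.e. $F(a,b)=F(b,a)$ for all $a,b\in A$.
   Context: Algebras are vector spaces with a bilinear multiplication $P(x,y)=xy$, not assumed associative or unital. For a linear map $T$ and a bilinear map $B$ on a vector space put $[T,B](x,y)=T(B(x,y))-B(T(x),y)-B(x,T(y))$; this is again a bilinear map. $L_a$ denotes the left multiplication $L_a(x)=ax$. An algebra $A$ with multiplication $P$ is called conservative if there exists a bilinear multiplication $F$ on the vector space $A$ such that $[L_b,[L_a,P]]=-[L_{F(a,b)},P]$ for all $a,b\in A$. For such an $F$, the vector space $A$ with multiplication $F$ is called an algebra associated to $A$, and is denoted $A^*$. *)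

theory Defs
  imports Complex_Main
begin

(* An algebra over k is a vector space, given by its scalar multiplication on the whole type,
   with a curried bilinear multiplication P; no associativity or unit is assumed. *)

definition bilinear_mult ::
  "('k::field \<Rightarrow> 'a::ab_group_add \<Rightarrow> 'a) \<Rightarrow> ('a \<Rightarrow> 'a \<Rightarrow> 'a) \<Rightarrow> bool"
  where "bilinear_mult scale B \<longleftrightarrow>
    (\<forall>x. Vector_Spaces.linear scale scale (\<lambda>y. B x y)) \<and>
    (\<forall>y. Vector_Spaces.linear scale scale (\<lambda>x. B x y))"

definition left_mult :: "('a \<Rightarrow> 'a \<Rightarrow> 'a) \<Rightarrow> 'a \<Rightarrow> 'a \<Rightarrow> 'a"
  where "left_mult P a = (\<lambda>x. P a x)"

definition bracket ::
  "('a::ab_group_add \<Rightarrow> 'a) \<Rightarrow> ('a \<Rightarrow> 'a \<Rightarrow> 'a) \<Rightarrow> 'a \<Rightarrow> 'a \<Rightarrow> 'a"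
  where "bracket T B = (\<lambda>x y. T (B x y) - B (T x) y - B x (T y))"

definition left_commutative :: "('a \<Rightarrow> 'a \<Rightarrow> 'a) \<Rightarrow> bool"
  where "left_commutative P \<longleftrightarrow> (\<forall>a b x. P a (P b x) = P b (P a x))"

definition annihilator :: "('a::zero \<Rightarrow> 'a \<Rightarrow> 'a) \<Rightarrow> 'a set"
  where "annihilator P = {z. \<forall>y. P z y = 0}"

definition associated_mult ::
  "('k::field \<Rightarrow> 'a::ab_group_add \<Rightarrow> 'a) \<Rightarrow> ('a \<Rightarrow> 'a \<Rightarrow> 'a) \<Rightarrow> ('a \<Rightarrow> 'a \<Rightarrow> 'a) \<Rightarrow> bool"
  where "associated_mult scale P F \<longleftrightarrow>
    bilinear_mult scale F \<and>
    (\<forall>a b. bracket (left_mult P b) (bracket (left_mult P a) P) =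
           (\<lambda>x y. - bracket (left_mult P (F a b)) P x y))"

definition conservative ::
  "('k::field \<Rightarrow> 'a::ab_group_add \<Rightarrow> 'a) \<Rightarrow> ('a \<Rightarrow> 'a \<Rightarrow> 'a) \<Rightarrow> bool"
  where "conservative scale P \<longleftrightarrow> (\<exists>F. associated_mult scale P F)"

end

theory Submission
  imports Defs
begin

text \<open>
  Left-commutativity says that \<open>L\<^sub>a\<close> passes through the second argument of the
  multiplication, \<open>a(xy) = x(ay)\<close>, so two of the three terms of a bracket with \<open>L\<^sub>a\<close> cancel and
  only the action on the first argument survives, with a minus sign. Applied twice, this gives
  \<open>[L\<^sub>b,[L\<^sub>a,P]](x,y) = (a(bx))y\<close>, while \<open>-[L\<^sub>c,P](x,y) = (cx)y\<close>. Conservativity therefore reads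
  \<open>(a(bx))y = (F(a,b)x)y\<close> for all \<open>y\<close>, and the zero annihilator allows \<open>y\<close> to be dropped. Now
  \<open>F(a,b)x = a(bx)\<close> is symmetric in \<open>a\<close> and \<open>b\<close>, and dropping \<open>x\<close> in the same way yields the
  commutativity of \<open>F\<close>.
\<close>

lemma bilinear_mult_diff_left:
  assumes "bilinear_mult scale P"
  shows "P (u - v) y = P u y - P v y"
  using assms unfolding bilinear_mult_def
  by (metis (mono_tags, lifting) Vector_Spaces.linear_def module_hom.diff)

lemma bilinear_mult_minus_right:
  assumes "bilinear_mult scale P"
  shows "P x (- y) = - P x y"
  using assms unfolding bilinear_mult_def
  by (metis (mono_tags, lifting) Vector_Spaces.linear_def module_hom.neg)

text \<open>
  The annihilator is the kernel of the linear map \<open>a \<mapsto> L\<^sub>a\<close>, so its vanishing lets a factor on the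
  right be dropped from an identity that holds for all its values.
\<close>

lemma left_mult_faithful:
  assumes "bilinear_mult scale P" "annihilator P = {0}" "\<And>y. P u y = P v y"
  shows "u = v"
proof -
  have "u - v \<in> annihilator P"
    using assms(3) by (simp add: annihilator_def bilinear_mult_diff_left[OF assms(1)])
  then show ?thesis
    using assms(2) by simp
qed

text \<open>The terms \<open>a(xy)\<close> and \<open>x(ay)\<close> cancel by left-commutativity.\<close>

lemma bracket_left_mult:
  fixes P :: "'a::ab_group_add \<Rightarrow> 'a \<Rightarrow> 'a"
  assumes "left_commutative P"
  shows "bracket (left_mult P a) P x y = - P (P a x) y"
proof -
  have "P a (P x y) = P x (P a y)"
    using assms unfolding left_commutative_def by blast
  then show ?thesis
    by (simp add: bracket_def left_mult_def)
qed

text \<open>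
  The same cancellation occurs at the second level because \<open>(ax)y\<close> is itself a left
  multiplication applied to \<open>y\<close>, so \<open>L\<^sub>b\<close> passes through it: \<open>b((ax)y) = (ax)(by)\<close>.
\<close>

lemma bracket_bracket_left_mult:
  assumes "bilinear_mult scale P" "left_commutative P"
  shows "bracket (left_mult P b) (bracket (left_mult P a) P) x y = P (P a (P b x)) y"
proof -
  have "P b (P (P a x) y) = P (P a x) (P b y)"
    using assms(2) unfolding left_commutative_def by blast
  moreover have "bracket (left_mult P b) (bracket (left_mult P a) P) x y
      = P b (- P (P a x) y) + P (P a (P b x)) y + P (P a x) (P b y)"
    unfolding bracket_def[of "left_mult P b"] bracket_left_mult[OF assms(2)]
    by (simp add: left_mult_def)
  ultimately show ?thesis
    by (simp add: bilinear_mult_minus_right[OF assms(1)])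
qed

theorem theorem1:
  fixes scale :: "'k::field_char_0 \<Rightarrow> 'a::ab_group_add \<Rightarrow> 'a"
    and P F :: "'a \<Rightarrow> 'a \<Rightarrow> 'a"
  assumes "vector_space scale"
    and "bilinear_mult scale P"
    and "left_commutative P"
    and "conservative scale P"
    and "associated_mult scale P F"
    and "annihilator P = {0}"
  shows "(\<forall>a b x. P (F a b) x = P a (P b x)) \<and> (\<forall>a b. F a b = F b a)"
proof -
  have generalized_assoc: "P (F a b) x = P a (P b x)" for a b x
  proof (rule left_mult_faithful[OF assms(2,6)])
    fix y
    have "bracket (left_mult P b) (bracket (left_mult P a) P) x y
        = - bracket (left_mult P (F a b)) P x y"
      using assms(5) unfolding associated_mult_def by metis
    then show "P (P (F a b) x) y = P (P a (P b x)) y"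
      by (simp add: bracket_bracket_left_mult[OF assms(2,3)] bracket_left_mult[OF assms(3)])
  qed
  have "F a b = F b a" for a b
  proof (rule left_mult_faithful[OF assms(2,6)])
    fix x
    show "P (F a b) x = P (F b a) x"
      using assms(3) by (simp add: generalized_assoc left_commutative_def)
  qed
  with generalized_assoc show ?thesis
    by blast
qed

end
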